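(* There exists a sequence of real numbers $(a_\nu)_{\nu\ge 1}$ such that, as $n\to\infty$ through the positive integers, $$\int_0^\infty\left(\frac{\sin x}{x}\right)^n\,dx \approx \sqrt{\frac{3\pi}{2n}}\left(1+\sum_{\nu=1}^\infty \frac{a_\nu}{n^\nu}\right)$$ in the sense of Poincaré asymptotic series, that is, for every fixed integer $k\ge 0$, $$\sqrt{\frac{2n}{3\pi}}\int_0^\infty\left(\frac{\sin x}{x}\right)^n\,dx = 1+\sum_{\nu=1}^k \frac{a_\nu}{n^\nu}+\mathcal{O}\left(n^{-k-1}\right).$$
   Context: The integral is regarded as a function of the positive integer $n$ (for $n=1$ it is a convergent improper Riemann integral, $\lim_{T\to\infty}\int_0^T$). For a function $f$ of the positive integer $n$, one writes $f(n)\approx\sum_{\nu=0}^\infty \frac{a_\nu}{n^\nu}$ if for every fixed $k$ we have $f(n)=\sum_{\nu=0}^k \frac{a_\nu}{n^\nu}+\mathcal{O}(n^{-k-1})$, where the implied constant may depend on $k$. Convergence of the series is not claimed. *)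

theory Defs
  imports "HOL-Probability.Sinc_Integral" "HOL-Library.Landau_Symbols"
begin

text \<open>
  The improper Riemann integral of \<open>(sin x / x)^n\<close> over the positive half-line. On each \<open>[0, T]\<close> the
  Riemann integral is the library's \<^const>\<open>integral\<close>, which agrees with it here. The integrand is
  \<open>0\<close> at \<open>x = 0\<close> for \<open>n \<ge> 1\<close>, since division by zero yields \<open>0\<close>; the value at one point does not
  affect the integral. Only \<open>n \<ge> 1\<close> is meaningful (the integral diverges for \<open>n = 0\<close>).
\<close>

definition sinc_power_integral :: "nat \<Rightarrow> real" where
  "sinc_power_integral n = Lim at_top (\<lambda>T. integral {0..T} (\<lambda>x. (sin x / x) ^ n))"

text \<open>
  For \<open>n \<ge> 1\<close> the limit exists, so the value above is the genuine integral. For \<open>n \<ge> 2\<close> the integrand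
  is dominated by \<open>2 / (1 + x\<^sup>2)\<close>.
\<close>

lemma integrable_on_sinc_power: "(\<lambda>x. (sin x / x) ^ n :: real) integrable_on {0..T}"
proof -
  have "continuous_on {0..T} (\<lambda>x. sinc x ^ n)"
    by (intro continuous_intros)
  then have "(\<lambda>x. sinc x ^ n) integrable_on {0..T}"
    by (rule integrable_continuous_interval)
  then show ?thesis
    by (rule integrable_spike_finite[of "{0}", rotated 2]) auto
qed

lemma sinc_power_bound:
  assumes "n \<ge> 2"
  shows "\<bar>(sin x / x) ^ n\<bar> \<le> 2 * inverse (1 + x\<^sup>2 :: real)"
proof (cases "x = 0")
  case True
  then show ?thesis using assms by (simp add: zero_power)
next
  case False
  have le1: "\<bar>sin x / x\<bar> \<le> 1"
    using abs_sin_le_one[of x] abs_sin_x_le_abs_x[of x] False by (simp add: field_simps)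
  have "(sin x)\<^sup>2 \<le> x\<^sup>2"
    using abs_sin_x_le_abs_x[of x] by (simp add: abs_le_square_iff)
  moreover have "x\<^sup>2 * (sin x)\<^sup>2 \<le> x\<^sup>2 * 1"
    by (intro mult_left_mono) (auto simp: abs_square_le_1)
  ultimately have *: "(1 + x\<^sup>2) * (sin x)\<^sup>2 \<le> 2 * x\<^sup>2"
    by (simp add: algebra_simps)
  have pos: "0 < 1 + x\<^sup>2"
    by (simp add: add_pos_nonneg)
  have "\<bar>(sin x / x) ^ n\<bar> \<le> \<bar>sin x / x\<bar> ^ 2"
    unfolding power_abs by (rule power_decreasing) (use assms le1 in auto)
  also have "\<dots> = (sin x)\<^sup>2 / x\<^sup>2"
    by (simp add: power_divide)
  also have "\<dots> \<le> 2 * inverse (1 + x\<^sup>2)"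
    using * pos False by (simp add: field_simps)
  finally show ?thesis .
qed

lemma sinc_power_integral_converges:
  assumes "n \<ge> 1"
  shows "((\<lambda>T. integral {0..T} (\<lambda>x. (sin x / x) ^ n)) \<longlongrightarrow> sinc_power_integral n) at_top"
proof -
  have "\<exists>L :: real. ((\<lambda>T. integral {0..T} (\<lambda>x. (sin x / x) ^ n)) \<longlongrightarrow> L) at_top"
  proof (cases "n = 1")
    case True
    have "eventually (\<lambda>T. Si T = integral {0..T} (\<lambda>x. (sin x / x) ^ n)) at_top"
      using eventually_ge_at_top[of 0]
    proof eventually_elim
      case (elim T)
      have si: "set_integrable lborel {0..T} sinc"
        by (rule borel_integrable_atLeastAtMost') (intro continuous_intros)
      have "Si T = (LBINT x=0..T. sinc x)"
        unfolding Si_def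
        by (rule interval_lebesgue_integral_cong_AE)
           (use elim sinc_AE in \<open>auto simp: zero_ereal_def\<close>)
      also have "\<dots> = integral {0..T} sinc"
        using interval_integral_eq_integral[OF elim si] by (simp add: zero_ereal_def)
      also have "\<dots> = integral {0..T} (\<lambda>x. (sin x / x) ^ n)"
        by (rule integral_spike[of "{0}"]) (auto simp: True)
      finally show ?case .
    qed
    from Lim_transform_eventually[OF Si_at_top this] show ?thesis
      by (rule exI)
  next
    case False
    with assms have n: "n \<ge> 2" by simp
    define f where "f = (\<lambda>x. indicator {0..} x * (sin x / x) ^ n :: real)"
    have "integrable lborel (\<lambda>x. 2 * inverse (1 + x\<^sup>2 :: real))"
      using integrable_inverse_1_plus_square by (simp add: set_integrable_def)
    then have int: "integrable lborel f"
    proof (rule Bochner_Integration.integrable_bound)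
      show "AE x in lborel. norm (f x) \<le> norm (2 * inverse (1 + x\<^sup>2))"
        using sinc_power_bound[OF n]
        by (auto simp: f_def indicator_def)
    qed (simp add: f_def)
    have "((\<lambda>T. LINT x|lborel. indicator {..T} x *\<^sub>R f x) \<longlongrightarrow> integral\<^sup>L lborel f) at_top"
      by (rule tendsto_integral_at_top) (use int in auto)
    moreover have "(LINT x|lborel. indicator {..T} x *\<^sub>R f x)
        = integral {0..T} (\<lambda>x. (sin x / x) ^ n)" for T
    proof -
      have eq: "indicator {..T} x *\<^sub>R f x = indicator {0..T} x *\<^sub>R (sin x / x) ^ n" for x
        by (auto simp: f_def indicator_def)
      have "integrable lborel (\<lambda>x. indicator {..T} x *\<^sub>R f x)"
        using int by (rule integrable_mult_indicator[rotated]) simp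
      then have "set_integrable lborel {0..T} (\<lambda>x. (sin x / x) ^ n)"
        unfolding set_integrable_def eq .
      from set_borel_integral_eq_integral(2)[OF this] show ?thesis
        unfolding eq by (simp add: set_lebesgue_integral_def)
    qed
    ultimately show ?thesis by auto
  qed
  then obtain L :: real where L: "((\<lambda>T. integral {0..T} (\<lambda>x. (sin x / x) ^ n)) \<longlongrightarrow> L) at_top" ..
  moreover have "sinc_power_integral n = L"
    unfolding sinc_power_integral_def by (rule tendsto_Lim[OF trivial_limit_at_top_linorder L])
  ultimately show ?thesis by simp
qed

end

theory Submission
  imports Defs "HOL-Complex_Analysis.Cauchy_Integral_Formula" "HOL-Real_Asymp.Real_Asymp"
begin

text \<open>
  Near the origin \<open>sin x / x = exp (- s(x)\<^sup>2)\<close>, where \<open>s\<close> is holomorphic, real on the real axis and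
  \<open>s'(0) = 1 / sqrt 6\<close>: the function \<open>- ln (sin z / z)\<close> has a double zero at the origin with leading
  term \<open>z\<^sup>2 / 6\<close>, and \<open>s\<close> is its square root (\<open>sinc_gaussian_phase\<close>). Away from the origin
  \<open>\<bar>sin x / x\<bar>\<close> stays below a constant \<open>c < 1\<close>, so this range contributes \<open>O(c^n)\<close>
  (\<open>sinc_power_integral_tail_le\<close>). By symmetry, half of \<open>J 1 n\<close> remains, where
  \<open>J f n = \<integral> f(x) exp (- n s(x)\<^sup>2) dx\<close> is taken over a fixed interval \<open>[-\<delta>, \<delta>]\<close>.

  The expansion of \<open>J f\<close> comes from integration by parts, for all holomorphic \<open>f\<close> at once. The
  function \<open>f - (f(0) / s'(0)) s'\<close> vanishes at \<open>0\<close>, hence equals \<open>2 s s' g\<close> with \<open>g\<close> holomorphic,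
  and \<open>2 n s s' exp (- n s\<^sup>2)\<close> is the derivative of \<open>- exp (- n s\<^sup>2)\<close>. Therefore
  \<open>J f n = (f(0) / s'(0)) J s' n + J g' n / n\<close> up to boundary terms, which are exponentially small.
  Moreover the substitution \<open>t = s(x)\<close> turns \<open>J s' n\<close> into a truncated Gaussian integral, which is
  \<open>sqrt (\<pi> / n)\<close> up to an exponentially small error (\<open>J_recursion\<close>). Since \<open>g'\<close> is again
  holomorphic, the recursion can be iterated, and each round produces one more coefficient; it may
  be stopped anywhere, because \<open>J f n = O(n powr (-1/2))\<close> for every \<open>f\<close> (\<open>asymptotic_expansion\<close>).
  The case \<open>f = 1\<close> gives the theorem, with leading constant
  \<open>sqrt (6 \<pi> / n) / 2 = sqrt (3 \<pi> / (2 n))\<close>.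
\<close>

section \<open>Gaussian integrals and exponentially small errors\<close>

text \<open>
  The factor \<open>sqrt n\<close> is the normalisation of the Laplace integrals below; geometric decay absorbs it
  together with any power of \<open>n\<close>.
\<close>

lemma geometric_bigo_inverse_power:
  fixes e :: "nat \<Rightarrow> real"
  assumes "0 < q" "q < 1" and bound: "\<forall>\<^sub>F n in sequentially. \<bar>e n\<bar> \<le> C * sqrt (real n) * q ^ n"
  shows "e \<in> O(\<lambda>n. 1 / real n ^ k)"
proof -
  have "(\<lambda>n. sqrt (real n) * q ^ n) \<in> O(\<lambda>n. 1 / real n ^ k)"
    using assms(1,2) by real_asymp
  moreover have "e \<in> O(\<lambda>n. sqrt (real n) * q ^ n)"
    by (rule bigoI[of _ C]) (rule eventually_mono[OF bound], use assms(1) in \<open>simp add: mult.assoc\<close>)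
  ultimately show ?thesis by (metis landau_o.big_trans)
qed

lemma has_integral_gaussian:
  fixes a :: real
  assumes "a > 0"
  shows "((\<lambda>t. exp (- (a * t\<^sup>2))) has_integral sqrt (pi / a)) UNIV"
proof -
  define \<sigma> where "\<sigma> = 1 / sqrt (2 * a)"
  have \<sigma>: "\<sigma> > 0" "\<sigma>\<^sup>2 = 1 / (2 * a)" using assms by (auto simp: \<sigma>_def power_divide)
  have "(normal_density 0 \<sigma> has_integral 1) UNIV"
    using has_integral_integral_lborel[OF integrable_normal_density[OF \<sigma>(1)], of 0] integral_normal_density[OF \<sigma>(1), of 0] 
    by simp
  then have "((\<lambda>t. sqrt (pi / a) * normal_density 0 \<sigma> t) has_integral sqrt (pi / a) * 1) UNIV"
    by (rule has_integral_mult_right)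
  moreover have "sqrt (pi / a) * normal_density 0 \<sigma> t = exp (- (a * t\<^sup>2))" for t
    using assms by (simp add: normal_density_def \<sigma>(2) real_sqrt_divide field_simps)
  ultimately show ?thesis by simp
qed

text \<open>
  Outside \<open>[A, B]\<close> we have \<open>\<bar>t\<bar> \<ge> \<rho>\<close>, so \<open>exp (- n t\<^sup>2)\<close> is at most \<open>exp (- (n - 1) \<rho>\<^sup>2) exp (- t\<^sup>2)\<close>.
  One factor \<open>exp (- t\<^sup>2)\<close> is kept to make the bound integrable over the whole line; it accounts for
  the \<open>sqrt pi\<close>.
\<close>

lemma truncated_gaussian_integral:
  fixes A B \<rho> :: real
  assumes "A \<le> -\<rho>" "\<rho> \<le> B" "\<rho> > 0" "n \<ge> 1"
  defines "I \<equiv> integral {A..B} (\<lambda>t. exp (- (real n * t\<^sup>2)))"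
  shows "I \<le> sqrt (pi / real n)" "sqrt (pi / real n) - I \<le> exp (- ((real n - 1) * \<rho>\<^sup>2)) * sqrt pi"
proof -
  let ?g = "\<lambda>t. exp (- (real n * t\<^sup>2)) :: real"
  have G: "(?g has_integral sqrt (pi / real n)) UNIV"
    using has_integral_gaussian[of "real n"] assms by simp
  have "(?g has_integral I) {A..B}"
    unfolding I_def by (intro integrable_integral integrable_continuous_interval continuous_intros)
  then have R: "((\<lambda>t. if t \<in> {A..B} then ?g t else 0) has_integral I) UNIV"
    by (simp only: has_integral_restrict_UNIV)
  show "I \<le> sqrt (pi / real n)"
    by (rule has_integral_le[OF R G]) auto
  have D: "((\<lambda>t. ?g t - (if t \<in> {A..B} then ?g t else 0)) has_integral sqrt (pi / real n) - I) UNIV"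
    by (rule has_integral_diff[OF G R])
  have E: "((\<lambda>t. exp (- ((real n - 1) * \<rho>\<^sup>2)) * exp (- (1 * t\<^sup>2))) has_integral
      exp (- ((real n - 1) * \<rho>\<^sup>2)) * sqrt (pi / 1)) UNIV"
    by (rule has_integral_mult_right[OF has_integral_gaussian]) simp
  have "sqrt (pi / real n) - I \<le> exp (- ((real n - 1) * \<rho>\<^sup>2)) * sqrt (pi / 1)"
  proof (rule has_integral_le[OF D E])
    fix t :: real
    show "?g t - (if t \<in> {A..B} then ?g t else 0) \<le> exp (- ((real n - 1) * \<rho>\<^sup>2)) * exp (- (1 * t\<^sup>2))"
    proof (cases "t \<in> {A..B}")
      case False
      then have "\<rho> \<le> \<bar>t\<bar>" using assms by auto
      then have "\<rho>\<^sup>2 \<le> t\<^sup>2" using assms(3) by (simp add: abs_le_square_iff[symmetric])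
      then have "(real n - 1) * \<rho>\<^sup>2 \<le> (real n - 1) * t\<^sup>2"
        using assms(4) by (intro mult_left_mono) auto
      with False show ?thesis by (simp add: exp_add[symmetric] algebra_simps)
    qed simp
  qed
  then show "sqrt (pi / real n) - I \<le> exp (- ((real n - 1) * \<rho>\<^sup>2)) * sqrt pi" by simp
qed

section \<open>Division at a zero of a holomorphic function\<close>

lemma holomorphic_div_zero:
  fixes f :: "complex \<Rightarrow> complex"
  assumes "f holomorphic_on S" "open S" "f 0 = 0"
  shows "(\<lambda>z. if z = 0 then deriv f 0 else f z / z) holomorphic_on S"
  by (rule pole_theorem_open_0[OF assms(1,2), of 0]) (use assms in auto)

lemma holomorphic_simple_zero_dvd:
  fixes f d :: "complex \<Rightarrow> complex"
  assumes "f holomorphic_on S" "d holomorphic_on S" "open S" "f 0 = 0" "d 0 = 0"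
    "deriv d 0 \<noteq> 0" "\<And>z. z \<in> S \<Longrightarrow> z \<noteq> 0 \<Longrightarrow> d z \<noteq> 0"
  obtains g where "g holomorphic_on S" "\<And>z. z \<in> S \<Longrightarrow> f z = d z * g z"
proof
  let ?g = "\<lambda>z. (if z = 0 then deriv f 0 else f z / z) / (if z = 0 then deriv d 0 else d z / z)"
  show "?g holomorphic_on S"
    using assms by (intro holomorphic_on_divide holomorphic_div_zero) auto
  show "f z = d z * ?g z" if "z \<in> S" for z
    using assms that by auto
qed

section \<open>Laplace integrals with a holomorphic phase\<close>

text \<open>
  The phase \<open>s\<close> enters through the kernel \<open>exp (- n s(x)\<^sup>2)\<close>. The lower bound on \<open>Re s'\<close> makes \<open>s\<close>
  increasing on the real segment, so that \<open>s\<close> can serve as the variable of integration, and also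
  bounds arbitrary amplitudes by a multiple of \<open>s'\<close>. The integrals run over \<open>[-\<delta>, \<delta>]\<close> with
  \<open>\<delta> < r\<close>, so that holomorphic functions on the disc are bounded there.
\<close>

locale gaussian_phase =
  fixes s :: "complex \<Rightarrow> complex" and r \<delta> m :: real
  assumes s_holo: "s holomorphic_on ball 0 r"
    and s_real: "\<And>x. \<bar>x\<bar> < r \<Longrightarrow> s (of_real x) \<in> \<real>"
    and s_0: "s 0 = 0"
    and s_nz: "\<And>z. z \<in> ball 0 r \<Longrightarrow> z \<noteq> 0 \<Longrightarrow> s z \<noteq> 0"
    and m_pos: "m > 0"
    and deriv_ge: "\<And>z. z \<in> ball 0 r \<Longrightarrow> m \<le> Re (deriv s z)"
    and \<delta>_pos: "\<delta> > 0" and \<delta>_less: "\<delta> < r"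
begin

definition \<sigma> :: "real \<Rightarrow> real" where
  "\<sigma> x = Re (s (of_real x))"

definition weight :: "nat \<Rightarrow> real \<Rightarrow> real" where
  "weight n x = exp (- (real n * (\<sigma> x)\<^sup>2))"

definition J :: "(complex \<Rightarrow> complex) \<Rightarrow> nat \<Rightarrow> complex" where
  "J f n = integral {-\<delta>..\<delta>} (\<lambda>x. f (of_real x) * of_real (weight n x))"

lemma in_ball: "x \<in> {-\<delta>..\<delta>} \<Longrightarrow> complex_of_real x \<in> ball 0 r"
  using \<delta>_less by auto

lemma deriv_s: "z \<in> ball 0 r \<Longrightarrow> (s has_field_derivative deriv s z) (at z)"
  using holomorphic_derivI[OF s_holo] by auto

lemma continuous_on_real_segment:
  assumes "f holomorphic_on ball 0 r"
  shows "continuous_on {-\<delta>..\<delta>} (\<lambda>x. f (complex_of_real x))"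
proof (rule continuous_on_compose2[OF holomorphic_on_imp_continuous_on[OF assms]])
  show "continuous_on {-\<delta>..\<delta>} complex_of_real" by (intro continuous_intros)
  show "complex_of_real ` {-\<delta>..\<delta>} \<subseteq> ball 0 r" using in_ball by blast
qed

lemma continuous_weight: "continuous_on {-\<delta>..\<delta>} (weight n)"
  unfolding weight_def \<sigma>_def by (intro continuous_intros continuous_on_real_segment s_holo)

lemma J_integrable:
  "f holomorphic_on ball 0 r \<Longrightarrow> (\<lambda>x. f (of_real x) * of_real (weight n x)) integrable_on {-\<delta>..\<delta>}"
  by (intro integrable_continuous_interval continuous_intros continuous_on_real_segment continuous_weight)

lemma \<sigma>_deriv:
  assumes "x \<in> {-\<delta>..\<delta>}"
  shows "(\<sigma> has_real_derivative Re (deriv s (of_real x))) (at x within T)"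
  unfolding \<sigma>_def[abs_def]
  by (intro has_field_derivative_Re has_vector_derivative_real_field deriv_s in_ball assms)

text \<open>
  The imaginary part of \<open>s\<close> vanishes on the real axis, hence so does its derivative along it.
\<close>

lemma deriv_s_real:
  assumes "x \<in> {-\<delta>..\<delta>}"
  shows "deriv s (of_real x) = of_real (Re (deriv s (of_real x)))"
proof -
  have "((\<lambda>x. Im (s (of_real x))) has_real_derivative Im (deriv s (of_real x))) (at x)"
    by (intro has_field_derivative_Im has_vector_derivative_real_field deriv_s in_ball assms)
  moreover have "((\<lambda>x. Im (s (of_real x))) has_real_derivative 0) (at x)"
  proof -
    have "\<forall>\<^sub>F y in nhds x. y \<in> {-r<..<r}"
      using assms \<delta>_less by (intro eventually_nhds_in_open) auto
    then have "\<forall>\<^sub>F y in nhds x. Im (s (of_real y)) = 0"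
      by eventually_elim (use s_real in \<open>auto simp: complex_is_Real_iff abs_less_iff\<close>)
    then show ?thesis
      using DERIV_cong_ev[of x x "\<lambda>x. Im (s (of_real x))" "\<lambda>_. 0" 0 0] by simp
  qed
  ultimately have "Im (deriv s (of_real x)) = 0" by (rule DERIV_unique)
  then show ?thesis by (simp add: complex_eq_iff)
qed

lemma s_eq_\<sigma>: "x \<in> {-\<delta>..\<delta>} \<Longrightarrow> s (of_real x) = of_real (\<sigma> x)"
  using s_real[of x] \<delta>_less by (auto simp: abs_less_iff complex_is_Real_iff complex_eq_iff \<sigma>_def)

lemma \<sigma>_less:
  assumes "-\<delta> \<le> a" "a < b" "b \<le> \<delta>"
  shows "\<sigma> a < \<sigma> b"
proof (rule DERIV_pos_imp_increasing[OF assms(2)])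
  fix x assume "a \<le> x" "x \<le> b"
  with assms have x: "x \<in> {-\<delta>..\<delta>}" by simp
  show "\<exists>y. (\<sigma> has_real_derivative y) (at x) \<and> 0 < y"
    using \<sigma>_deriv[OF x] deriv_ge[OF in_ball[OF x]] m_pos by (intro exI[of _ "Re (deriv s (of_real x))"] conjI) auto
qed

lemma \<sigma>_ends: "\<sigma> (-\<delta>) < 0" "\<sigma> \<delta> > 0"
  using \<sigma>_less[of "-\<delta>" 0] \<sigma>_less[of 0 \<delta>] \<delta>_pos s_0 \<sigma>_def[of 0] by simp_all

lemma \<sigma>_mono:
  "-\<delta> \<le> a \<Longrightarrow> a \<le> b \<Longrightarrow> b \<le> \<delta> \<Longrightarrow> \<sigma> a \<le> \<sigma> b"
  using \<sigma>_less[of a b] by (cases "a = b") auto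

text \<open>
  This is the one amplitude whose integral is known: substitute \<open>t = \<sigma>(x)\<close>.
\<close>

lemma has_integral_deriv_s_weight:
  "((\<lambda>x. Re (deriv s (of_real x)) * weight n x) has_integral
     integral {\<sigma> (-\<delta>)..\<sigma> \<delta>} (\<lambda>t. exp (- (real n * t\<^sup>2)))) {-\<delta>..\<delta>}"
proof -
  have "((\<lambda>x. Re (deriv s (of_real x)) *\<^sub>R exp (- (real n * (\<sigma> x)\<^sup>2))) has_integral
     integral {\<sigma> (-\<delta>)..\<sigma> \<delta>} (\<lambda>t. exp (- (real n * t\<^sup>2)))) {-\<delta>..\<delta>}"
  proof (rule has_integral_substitution[where c = "\<sigma> (-\<delta>)" and d = "\<sigma> \<delta>"])
    show "\<sigma> (-\<delta>) \<le> \<sigma> \<delta>" using \<sigma>_ends by simp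
    show "\<sigma> ` {-\<delta>..\<delta>} \<subseteq> {\<sigma> (-\<delta>)..\<sigma> \<delta>}" using \<sigma>_mono by auto
    show "(\<sigma> has_real_derivative Re (deriv s (of_real x))) (at x within {-\<delta>..\<delta>})"
      if "x \<in> {-\<delta>..\<delta>}" for x using that by (rule \<sigma>_deriv)
  qed (use \<delta>_pos in \<open>auto intro!: continuous_intros\<close>)
  then show ?thesis by (simp add: weight_def)
qed

lemma weight_eq_exp:
  assumes "x \<in> {-\<delta>..\<delta>}"
  shows "of_real (weight n x) = exp (- (of_nat n * (s (of_real x))\<^sup>2))"
  unfolding weight_def s_eq_\<sigma>[OF assms] by (simp add: exp_of_real[symmetric])

lemma holo_deriv_s: "deriv s holomorphic_on ball 0 r"
  by (rule holomorphic_deriv[OF s_holo]) simp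

lemma J_deriv_s:
  "J (deriv s) n = of_real (integral {\<sigma> (-\<delta>)..\<sigma> \<delta>} (\<lambda>t. exp (- (real n * t\<^sup>2))))"
proof -
  have "((\<lambda>x. complex_of_real (Re (deriv s (of_real x)) * weight n x)) has_integral
     of_real (integral {\<sigma> (-\<delta>)..\<sigma> \<delta>} (\<lambda>t. exp (- (real n * t\<^sup>2))))) {-\<delta>..\<delta>}"
    using has_integral_linear[OF has_integral_deriv_s_weight bounded_linear_of_real]
    by (simp add: o_def)
  then have "((\<lambda>x. deriv s (of_real x) * of_real (weight n x)) has_integral
     of_real (integral {\<sigma> (-\<delta>)..\<sigma> \<delta>} (\<lambda>t. exp (- (real n * t\<^sup>2))))) {-\<delta>..\<delta>}"
    by (rule has_integral_eq[rotated]) (simp add: deriv_s_real[symmetric])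
  then show ?thesis
    unfolding J_def by (rule integral_unique)
qed

text \<open>
  The image of \<open>[-\<delta>, \<delta>]\<close> under the phase contains \<open>[-\<rho>, \<rho>]\<close>, so \<open>exp (- \<rho>\<^sup>2)\<close> is a common ratio
  for all exponentially small errors.
\<close>

definition \<rho> :: real where "\<rho> = min (- \<sigma> (-\<delta>)) (\<sigma> \<delta>)"

lemma \<rho>_pos: "\<rho> > 0"
  using \<sigma>_ends by (simp add: \<rho>_def)

text \<open>
  Since \<open>Re s' \<ge> m\<close>, a bound \<open>\<bar>f\<bar> \<le> M\<close> gives \<open>\<bar>f\<bar> \<le> (M / m) Re s'\<close>, which reduces the claim to the
  Gaussian integral.
\<close>

lemma norm_J_bound:
  assumes f: "f holomorphic_on ball 0 r"
  obtains C where "\<And>n. n \<ge> 1 \<Longrightarrow> norm (J f n) \<le> C * sqrt (pi / real n)"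
proof -
  have "bounded ((\<lambda>x. f (complex_of_real x)) ` {-\<delta>..\<delta>})"
    by (intro compact_imp_bounded compact_continuous_image continuous_on_real_segment f) simp
  then obtain M where M: "M > 0" "\<And>x. x \<in> {-\<delta>..\<delta>} \<Longrightarrow> norm (f (of_real x)) \<le> M"
    unfolding bounded_pos by auto
  show ?thesis
  proof
    fix n :: nat assume n: "n \<ge> 1"
    let ?G = "integral {\<sigma> (-\<delta>)..\<sigma> \<delta>} (\<lambda>t. exp (- (real n * t\<^sup>2)))"
    have I: "((\<lambda>x. M / m * (Re (deriv s (of_real x)) * weight n x)) has_integral M / m * ?G) {-\<delta>..\<delta>}"
      by (rule has_integral_mult_right[OF has_integral_deriv_s_weight])
    have "norm (J f n) \<le> integral {-\<delta>..\<delta>} (\<lambda>x. M / m * (Re (deriv s (of_real x)) * weight n x))"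
      unfolding J_def
    proof (rule integral_norm_bound_integral[OF J_integrable[OF f] has_integral_integrable[OF I]])
      fix x assume x: "x \<in> {-\<delta>..\<delta>}"
      have "norm (f (of_real x)) * m \<le> M * Re (deriv s (of_real x))"
        using M(2)[OF x] deriv_ge[OF in_ball[OF x]] m_pos M(1) by (intro mult_mono) auto
      then have "norm (f (of_real x)) \<le> M / m * Re (deriv s (of_real x))"
        using m_pos by (simp add: field_simps)
      then have "norm (f (of_real x)) * weight n x \<le> M / m * Re (deriv s (of_real x)) * weight n x"
        by (rule mult_right_mono) (simp add: weight_def)
      then show "norm (f (of_real x) * of_real (weight n x))
          \<le> M / m * (Re (deriv s (of_real x)) * weight n x)"
        by (simp add: norm_mult weight_def mult.assoc)
    qed
    also have "\<dots> = M / m * ?G" using I by (rule integral_unique)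
    also have "\<dots> \<le> M / m * sqrt (pi / real n)"
      using truncated_gaussian_integral(1)[of "\<sigma> (-\<delta>)" \<rho> "\<sigma> \<delta>" n] \<rho>_pos n M(1) m_pos
      by (intro mult_left_mono) (auto simp: \<rho>_def)
    finally show "norm (J f n) \<le> M / m * sqrt (pi / real n)" .
  qed
qed

text \<open>
  The fundamental theorem of calculus for \<open>g exp (- n s\<^sup>2)\<close>.
\<close>

lemma J_by_parts:
  assumes g: "g holomorphic_on ball 0 r"
  shows "of_nat n * J (\<lambda>z. 2 * s z * deriv s z * g z) n
    = J (deriv g) n - (g (of_real \<delta>) * of_real (weight n \<delta>) - g (of_real (-\<delta>)) * of_real (weight n (-\<delta>)))"
proof -
  let ?F = "\<lambda>z. g z * exp (- (of_nat n * (s z)\<^sup>2))"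
  let ?F' = "\<lambda>z. deriv g z * exp (- (of_nat n * (s z)\<^sup>2))
      - of_nat n * ((2 * s z * deriv s z * g z) * exp (- (of_nat n * (s z)\<^sup>2)))"
  have g': "deriv g holomorphic_on ball 0 r" by (rule holomorphic_deriv[OF g]) simp
  have h: "(\<lambda>z. 2 * s z * deriv s z * g z) holomorphic_on ball 0 r"
    by (intro holomorphic_intros s_holo holo_deriv_s g)
  have "((\<lambda>x. ?F' (of_real x)) has_integral ?F (of_real \<delta>) - ?F (of_real (-\<delta>))) {-\<delta>..\<delta>}"
  proof (rule fundamental_theorem_of_calculus)
    fix x assume x: "x \<in> {-\<delta>..\<delta>}"
    have dg: "(g has_field_derivative deriv g (of_real x)) (at (of_real x))"
      using holomorphic_derivI[OF g _ in_ball[OF x]] by simp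
    have "(?F has_field_derivative ?F' (of_real x)) (at (of_real x))"
      by (rule derivative_eq_intros dg deriv_s[OF in_ball[OF x]] refl)+ (simp add: algebra_simps)
    then show "((\<lambda>x. ?F (of_real x)) has_vector_derivative ?F' (of_real x)) (at x within {-\<delta>..\<delta>})"
      by (rule has_vector_derivative_real_field)
  qed (use \<delta>_pos in simp)
  then have "((\<lambda>x. deriv g (of_real x) * of_real (weight n x)
      - of_nat n * ((2 * s (of_real x) * deriv s (of_real x) * g (of_real x)) * of_real (weight n x)))
      has_integral ?F (of_real \<delta>) - ?F (of_real (-\<delta>))) {-\<delta>..\<delta>}"
    by (rule has_integral_eq[rotated]) (simp add: weight_eq_exp)
  moreover have "((\<lambda>x. deriv g (of_real x) * of_real (weight n x)
      - of_nat n * ((2 * s (of_real x) * deriv s (of_real x) * g (of_real x)) * of_real (weight n x)))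
      has_integral J (deriv g) n - of_nat n * J (\<lambda>z. 2 * s z * deriv s z * g z) n) {-\<delta>..\<delta>}"
    unfolding J_def
    by (intro has_integral_diff has_integral_mult_right integrable_integral J_integrable g' J_integrable[OF h])
  ultimately have "?F (of_real \<delta>) - ?F (of_real (-\<delta>))
      = J (deriv g) n - of_nat n * J (\<lambda>z. 2 * s z * deriv s z * g z) n"
    by (rule has_integral_unique)
  moreover have "?F (of_real \<delta>) = g (of_real \<delta>) * of_real (weight n \<delta>)"
    "?F (of_real (-\<delta>)) = g (of_real (-\<delta>)) * of_real (weight n (-\<delta>))"
    using weight_eq_exp[of \<delta> n] weight_eq_exp[of "-\<delta>" n] \<delta>_pos by simp_all
  ultimately show ?thesis by (simp add: algebra_simps)
qed

text \<open>
  The multiple of \<open>s'\<close> is chosen so that the difference vanishes at the origin. It is then divisible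
  by \<open>2 s s'\<close>, whose only zero is a simple one at the origin, and integration by parts applies.
\<close>

lemma J_split:
  assumes f: "f holomorphic_on ball 0 r"
  obtains h C where "h holomorphic_on ball 0 r"
    "\<And>n. n \<ge> 1 \<Longrightarrow> norm (J f n - f 0 / deriv s 0 * J (deriv s) n - J h n / of_nat n)
        \<le> C * (exp (- \<rho>\<^sup>2)) ^ n"
proof -
  define c where "c = f 0 / deriv s 0"
  have r: "0 \<in> ball (0::complex) r" using \<delta>_pos \<delta>_less by simp
  have nz: "deriv s z \<noteq> 0" if "z \<in> ball 0 r" for z
    using deriv_ge[OF that] m_pos by auto
  let ?d = "\<lambda>z. 2 * s z * deriv s z"
  have dd: "(?d has_field_derivative 2 * deriv s 0 * deriv s 0) (at 0)"
  proof -
    have ds: "(deriv s has_field_derivative deriv (deriv s) 0) (at 0)"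
      using holomorphic_derivI[OF holo_deriv_s _ r] by simp
    show ?thesis
      by (rule derivative_eq_intros deriv_s[OF r] ds refl)+ (simp add: s_0)
  qed
  obtain g where g: "g holomorphic_on ball 0 r"
    and eq: "\<And>z. z \<in> ball 0 r \<Longrightarrow> f z - c * deriv s z = ?d z * g z"
  proof (rule holomorphic_simple_zero_dvd[of "\<lambda>z. f z - c * deriv s z" "ball 0 r" ?d])
    show "(\<lambda>z. f z - c * deriv s z) holomorphic_on ball 0 r"
      by (intro holomorphic_intros f holo_deriv_s)
    show "?d holomorphic_on ball 0 r"
      by (intro holomorphic_intros s_holo holo_deriv_s)
    show "f 0 - c * deriv s 0 = 0" using nz[OF r] by (simp add: c_def)
    show "deriv ?d 0 \<noteq> 0" using DERIV_imp_deriv[OF dd] nz[OF r] by simp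
  qed (auto simp: s_0 s_nz nz)
  have sub: "J f n - c * J (deriv s) n = J (\<lambda>z. ?d z * g z) n" for n
  proof -
    have "((\<lambda>x. f (of_real x) * of_real (weight n x) - c * (deriv s (of_real x) * of_real (weight n x)))
        has_integral J f n - c * J (deriv s) n) {-\<delta>..\<delta>}"
      unfolding J_def
      by (intro has_integral_diff has_integral_mult_right integrable_integral J_integrable f holo_deriv_s)
    then have "((\<lambda>x. (?d (of_real x) * g (of_real x)) * of_real (weight n x))
        has_integral J f n - c * J (deriv s) n) {-\<delta>..\<delta>}"
    proof (rule has_integral_eq[rotated])
      fix x assume x: "x \<in> {-\<delta>..\<delta>}"
      show "f (of_real x) * of_real (weight n x) - c * (deriv s (of_real x) * of_real (weight n x))
          = ?d (of_real x) * g (of_real x) * of_real (weight n x)"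
        unfolding eq[OF in_ball[OF x], symmetric] by (simp add: algebra_simps)
    qed
    then show ?thesis unfolding J_def by (rule integral_unique[symmetric])
  qed
  have w: "weight n x \<le> (exp (- \<rho>\<^sup>2)) ^ n" if "x = \<delta> \<or> x = -\<delta>" for n x
  proof -
    have "\<rho>\<^sup>2 \<le> (\<sigma> x)\<^sup>2"
      using that \<rho>_pos \<sigma>_ends by (subst abs_le_square_iff[symmetric]) (auto simp: \<rho>_def)
    then have "real n * \<rho>\<^sup>2 \<le> real n * (\<sigma> x)\<^sup>2" by (rule mult_left_mono) simp
    then show ?thesis by (simp add: weight_def exp_of_nat_mult[symmetric])
  qed
  show ?thesis
  proof
    show "deriv g holomorphic_on ball 0 r" by (rule holomorphic_deriv[OF g]) simp
    fix n :: nat assume n: "n \<ge> 1"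
    let ?B = "g (of_real \<delta>) * of_real (weight n \<delta>) - g (of_real (-\<delta>)) * of_real (weight n (-\<delta>))"
    have "J f n - c * J (deriv s) n - J (deriv g) n / of_nat n = - (?B / of_nat n)"
    proof -
      have "J (\<lambda>z. ?d z * g z) n = of_nat n * J (\<lambda>z. ?d z * g z) n / of_nat n"
        using n by simp
      also have "\<dots> = (J (deriv g) n - ?B) / of_nat n"
        unfolding J_by_parts[OF g] ..
      finally show ?thesis
        unfolding sub by (simp add: diff_divide_distrib del: of_real_minus)
    qed
    moreover have "norm (- (?B / of_nat n)) \<le> norm ?B"
      using n by (simp add: norm_divide divide_le_eq mult_le_cancel_left1 del: of_real_minus)
    moreover have "norm ?B \<le> norm (g (of_real \<delta>)) * (exp (- \<rho>\<^sup>2)) ^ n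
        + norm (g (of_real (-\<delta>))) * (exp (- \<rho>\<^sup>2)) ^ n"
    proof (rule order_trans[OF norm_triangle_ineq4 add_mono])
      have B: "norm (g (of_real x) * of_real (weight n x)) \<le> norm (g (of_real x)) * (exp (- \<rho>\<^sup>2)) ^ n"
        if "x = \<delta> \<or> x = -\<delta>" for x
        using mult_left_mono[OF w[OF that, of n] norm_ge_zero[of "g (of_real x)"]]
        by (simp add: norm_mult weight_def)
      show "norm (g (of_real \<delta>) * of_real (weight n \<delta>)) \<le> norm (g (of_real \<delta>)) * (exp (- \<rho>\<^sup>2)) ^ n"
        "norm (g (of_real (-\<delta>)) * of_real (weight n (-\<delta>))) \<le> norm (g (of_real (-\<delta>))) * (exp (- \<rho>\<^sup>2)) ^ n"
        using B[of \<delta>] B[of "-\<delta>"] by auto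
    qed
    ultimately show "norm (J f n - f 0 / deriv s 0 * J (deriv s) n - J (deriv g) n / of_nat n)
        \<le> (norm (g (of_real \<delta>)) + norm (g (of_real (-\<delta>)))) * (exp (- \<rho>\<^sup>2)) ^ n"
      unfolding c_def[symmetric] by (simp add: distrib_right del: of_real_minus)
  qed
qed

text \<open>
  Replacing the truncated Gaussian integral \<open>J s'\<close> by \<open>sqrt (\<pi> / n)\<close> changes the splitting of \<open>J f\<close>
  only by another exponentially small term.
\<close>

lemma J_recursion:
  assumes f: "f holomorphic_on ball 0 r"
  obtains h where "h holomorphic_on ball 0 r"
    "\<And>k. (\<lambda>n. sqrt (real n) * Re (J f n) - sqrt pi * Re (f 0 / deriv s 0)
        - sqrt (real n) * Re (J h n) / real n) \<in> O(\<lambda>n. 1 / real n ^ k)"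
proof -
  obtain h C where h: "h holomorphic_on ball 0 r" and
    C: "\<And>n. n \<ge> 1 \<Longrightarrow> norm (J f n - f 0 / deriv s 0 * J (deriv s) n - J h n / of_nat n)
        \<le> C * (exp (- \<rho>\<^sup>2)) ^ n"
    using J_split[OF f] by blast
  define c where "c = f 0 / deriv s 0"
  define q where "q = exp (- \<rho>\<^sup>2)"
  have q: "0 < q" "q < 1" using \<rho>_pos by (auto simp: q_def)
  define D where "D = C + \<bar>Re c\<bar> * (exp (\<rho>\<^sup>2) * sqrt pi)"
  show ?thesis
  proof
    show "h holomorphic_on ball 0 r" by (rule h)
    fix k
    show "(\<lambda>n. sqrt (real n) * Re (J f n) - sqrt pi * Re (f 0 / deriv s 0)
        - sqrt (real n) * Re (J h n) / real n) \<in> O(\<lambda>n. 1 / real n ^ k)"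
    proof (rule geometric_bigo_inverse_power[OF q])
      show "\<forall>\<^sub>F n in sequentially. \<bar>sqrt (real n) * Re (J f n) - sqrt pi * Re (f 0 / deriv s 0)
          - sqrt (real n) * Re (J h n) / real n\<bar> \<le> D * sqrt (real n) * q ^ n"
        using eventually_ge_at_top[of 1]
      proof eventually_elim
        case (elim n)
        define G where "G = integral {\<sigma> (-\<delta>)..\<sigma> \<delta>} (\<lambda>t. exp (- (real n * t\<^sup>2)))"
        have G: "\<bar>G - sqrt (pi / real n)\<bar> \<le> exp (\<rho>\<^sup>2) * sqrt pi * q ^ n"
        proof -
          have "\<bar>G - sqrt (pi / real n)\<bar> \<le> exp (- ((real n - 1) * \<rho>\<^sup>2)) * sqrt pi"
            using truncated_gaussian_integral[of "\<sigma> (-\<delta>)" \<rho> "\<sigma> \<delta>" n] \<rho>_pos elim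
            by (auto simp: \<rho>_def G_def)
          \<comment> \<open>The shift from \<open>n\<close> to \<open>n - 1\<close> costs the constant factor \<open>exp (\<rho>\<^sup>2)\<close>.\<close>
          also have "exp (- ((real n - 1) * \<rho>\<^sup>2)) = exp (\<rho>\<^sup>2) * q ^ n"
            by (simp add: q_def exp_of_nat_mult[symmetric] exp_add[symmetric] algebra_simps)
          finally show ?thesis by (simp add: algebra_simps)
        qed
        have "\<bar>Re (J f n - c * of_real G - J h n / of_nat n)\<bar> \<le> C * q ^ n"
          using order_trans[OF abs_Re_le_cmod C[OF elim]]
          unfolding J_deriv_s G_def[symmetric] c_def[symmetric] q_def[symmetric] .
        moreover have "\<bar>Re c * (G - sqrt (pi / real n))\<bar> \<le> \<bar>Re c\<bar> * (exp (\<rho>\<^sup>2) * sqrt pi * q ^ n)"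
          unfolding abs_mult by (rule mult_left_mono[OF G]) simp
        ultimately have "\<bar>Re (J f n) - Re c * sqrt (pi / real n) - Re (J h n) / real n\<bar> \<le> D * q ^ n"
          by (simp add: D_def algebra_simps)
        then have "sqrt (real n) * \<bar>Re (J f n) - Re c * sqrt (pi / real n) - Re (J h n) / real n\<bar>
            \<le> sqrt (real n) * (D * q ^ n)"
          by (rule mult_left_mono) simp
        moreover have "sqrt (real n) * \<bar>Re (J f n) - Re c * sqrt (pi / real n) - Re (J h n) / real n\<bar>
            = \<bar>sqrt (real n) * (Re (J f n) - Re c * sqrt (pi / real n) - Re (J h n) / real n)\<bar>"
          by (simp add: abs_mult)
        moreover have "sqrt (real n) * (Re (J f n) - Re c * sqrt (pi / real n) - Re (J h n) / real n)
           = sqrt (real n) * Re (J f n) - sqrt pi * Re c - sqrt (real n) * Re (J h n) / real n"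
          using elim by (simp add: real_sqrt_divide algebra_simps)
        ultimately show ?case unfolding c_def by (simp add: mult_ac)
      qed
    qed
  qed
qed

text \<open>
  If \<open>T f\<close> denotes the amplitude that the recursion produces from \<open>f\<close>, the coefficient of
  \<open>n^(-\<nu>)\<close> is \<open>sqrt pi Re ((T^\<nu> f)(0) / s'(0))\<close>. It does not depend on the order at which the
  expansion is truncated, so a single sequence serves all \<open>k\<close>.
\<close>

lemma asymptotic_expansion:
  assumes f: "f holomorphic_on ball 0 r"
  obtains a where "a 0 = sqrt pi * Re (f 0 / deriv s 0)"
    "\<And>k. (\<lambda>n. sqrt (real n) * Re (J f n) - (\<Sum>\<nu><k. a \<nu> / real n ^ \<nu>)) \<in> O(\<lambda>n. 1 / real n ^ k)"
proof -
  let ?H = "\<lambda>f. f holomorphic_on ball 0 r"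
  have "\<forall>f. \<exists>h. ?H f \<longrightarrow> ?H h \<and> (\<forall>k. (\<lambda>n. sqrt (real n) * Re (J f n) - sqrt pi * Re (f 0 / deriv s 0)
        - sqrt (real n) * Re (J h n) / real n) \<in> O(\<lambda>n. 1 / real n ^ k))"
  proof
    fix f
    show "\<exists>h. ?H f \<longrightarrow> ?H h \<and> (\<forall>k. (\<lambda>n. sqrt (real n) * Re (J f n) - sqrt pi * Re (f 0 / deriv s 0)
        - sqrt (real n) * Re (J h n) / real n) \<in> O(\<lambda>n. 1 / real n ^ k))"
    proof (cases "?H f")
      case True
      obtain h where "?H h" "\<And>k. (\<lambda>n. sqrt (real n) * Re (J f n) - sqrt pi * Re (f 0 / deriv s 0)
          - sqrt (real n) * Re (J h n) / real n) \<in> O(\<lambda>n. 1 / real n ^ k)"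
        using J_recursion[OF True] by blast
      then show ?thesis by (intro exI[of _ h]) simp
    qed simp
  qed
  then obtain T where T: "\<And>f. ?H f \<Longrightarrow> ?H (T f)" and
    R: "\<And>f k. ?H f \<Longrightarrow> (\<lambda>n. sqrt (real n) * Re (J f n) - sqrt pi * Re (f 0 / deriv s 0)
        - sqrt (real n) * Re (J (T f) n) / real n) \<in> O(\<lambda>n. 1 / real n ^ k)"
    unfolding choice_iff by blast
  define A where "A f \<nu> = sqrt pi * Re ((T ^^ \<nu>) f 0 / deriv s 0)" for f \<nu>
  \<comment> \<open>One step of the recursion for \<open>f\<close> reduces the claim for \<open>k + 1\<close> terms to \<open>k\<close> terms for \<open>T f\<close>.\<close>
  have main: "(\<lambda>n. sqrt (real n) * Re (J f n) - (\<Sum>\<nu><k. A f \<nu> / real n ^ \<nu>)) \<in> O(\<lambda>n. 1 / real n ^ k)"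
    if "?H f" for f k
    using that
  proof (induction k arbitrary: f)
    case 0
    obtain C where C: "\<And>n. n \<ge> 1 \<Longrightarrow> norm (J f n) \<le> C * sqrt (pi / real n)"
      using norm_J_bound[OF 0] by blast
    have "\<forall>\<^sub>F n in sequentially. norm (sqrt (real n) * Re (J f n)) \<le> (C * sqrt pi) * norm (1::real)"
      using eventually_ge_at_top[of 1]
    proof eventually_elim
      case (elim n)
      have "\<bar>Re (J f n)\<bar> \<le> C * sqrt (pi / real n)"
        using order_trans[OF abs_Re_le_cmod C[OF elim]] .
      then have "sqrt (real n) * \<bar>Re (J f n)\<bar> \<le> sqrt (real n) * (C * sqrt (pi / real n))"
        by (rule mult_left_mono) simp
      then show ?case using elim by (simp add: abs_mult real_sqrt_divide)
    qed
    then show ?case by (simp add: bigoI)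
  next
    case (Suc k)
    have "(\<lambda>n. 1 / real n * (sqrt (real n) * Re (J (T f) n) - (\<Sum>\<nu><k. A (T f) \<nu> / real n ^ \<nu>)))
        \<in> O(\<lambda>n. 1 / real n * (1 / real n ^ k))"
      by (rule landau_o.big.mult[OF landau_o.big_refl Suc.IH[OF T[OF Suc.prems]]])
    then have 1: "(\<lambda>n. 1 / real n * (sqrt (real n) * Re (J (T f) n) - (\<Sum>\<nu><k. A (T f) \<nu> / real n ^ \<nu>)))
        \<in> O(\<lambda>n. 1 / real n ^ Suc k)" by simp
    have 2: "A f (Suc \<nu>) = A (T f) \<nu>" for \<nu>
      by (simp add: A_def funpow_Suc_right del: funpow.simps)
    have eq: "sqrt (real n) * Re (J f n) - (\<Sum>\<nu><Suc k. A f \<nu> / real n ^ \<nu>)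
      = (sqrt (real n) * Re (J f n) - sqrt pi * Re (f 0 / deriv s 0) - sqrt (real n) * Re (J (T f) n) / real n)
        + 1 / real n * (sqrt (real n) * Re (J (T f) n) - (\<Sum>\<nu><k. A (T f) \<nu> / real n ^ \<nu>))" for n
    proof -
      have "(\<Sum>\<nu><Suc k. A f \<nu> / real n ^ \<nu>) = A f 0 + 1 / real n * (\<Sum>\<nu><k. A (T f) \<nu> / real n ^ \<nu>)"
        unfolding sum.lessThan_Suc_shift by (simp add: 2 sum_distrib_left divide_divide_eq_left)
      then show ?thesis by (simp add: A_def right_diff_distrib)
    qed
    then show ?case using sum_in_bigo(1)[OF R[OF Suc.prems] 1] by (simp only: eq)
  qed
  show ?thesis
    by (rule that[of "A f"]) (use main[OF f] in \<open>simp_all add: A_def\<close>)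
qed

end

section \<open>The square root of the logarithm of sin z / z\<close>

definition csinc :: "complex \<Rightarrow> complex" where
  "csinc z = (if z = 0 then 1 else sin z / z)"

lemma csinc_of_real: "csinc (of_real x) = of_real (sinc x)"
  by (simp add: csinc_def sin_of_real)

lemma holomorphic_csinc: "csinc holomorphic_on S"
proof -
  have "(\<lambda>z. if z = 0 then deriv sin 0 else sin z / z) holomorphic_on UNIV"
    by (rule holomorphic_div_zero) (auto intro: holomorphic_on_sin)
  also have "(\<lambda>z. if z = 0 then deriv sin 0 else sin z / z) = csinc"
    using DERIV_imp_deriv[OF DERIV_sin, of "0::complex"] by (auto simp: csinc_def)
  finally show ?thesis by (rule holomorphic_on_subset) simp
qed

text \<open>
  Lets a complex value be computed as a one-sided limit along the real axis, where real asymptotics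
  apply.
\<close>

lemma isCont_eq_real_limit:
  fixes f :: "complex \<Rightarrow> complex"
  assumes "isCont f 0" "((\<lambda>x. f (of_real x)) \<longlongrightarrow> L) (at_right 0)"
  shows "f 0 = L"
proof (rule tendsto_unique[OF _ _ assms(2)])
  have "filterlim complex_of_real (at 0) (at_right 0)"
    unfolding filterlim_at
    by (auto intro!: tendsto_eq_intros eventually_at_right_less simp: eventually_at_right_less
             intro: eventually_mono[OF eventually_at_right_less[of "0::real"]])
  then show "((\<lambda>x. f (of_real x)) \<longlongrightarrow> f 0) (at_right 0)"
    using assms(1) by (auto simp: isCont_def intro: filterlim_compose)
qed simp

text \<open>
  Near the origin \<open>sin z / z\<close> lies in the right half plane, so \<open>H = - Ln (sin z / z)\<close> is holomorphic
  there. The real expansion \<open>- ln (sin x / x) = x\<^sup>2 / 6 + o(x\<^sup>2)\<close> shows that \<open>H\<close> has a double zero,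
  so it can be divided by \<open>z\<close> twice; the quotient \<open>p\<close> has the value \<open>1 / 6\<close> at the origin.
\<close>

lemma log_csinc_eq_square_mult:
  obtains r p where "r > 0" "p holomorphic_on ball 0 r" "p 0 = 1 / 6"
    "\<And>z. z \<in> ball 0 r \<Longrightarrow> Re (p z) > 0"
    "\<And>z. z \<in> ball 0 r \<Longrightarrow> exp (- (z\<^sup>2 * p z)) = csinc z"
    "\<And>x. \<bar>x\<bar> < r \<Longrightarrow> p (of_real x) \<in> \<real>"
proof -
  have open_pos: "\<exists>r>0. \<forall>z\<in>ball 0 r. Re (f z) > 0"
    if f: "isCont f 0" "Re (f 0) > 0" for f :: "complex \<Rightarrow> complex"
  proof -
    have "((\<lambda>z. Re (f z)) \<longlongrightarrow> Re (f 0)) (nhds 0)"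
      using f(1) unfolding isCont_def tendsto_at_iff_tendsto_nhds by (intro tendsto_intros)
    then have "\<forall>\<^sub>F z in nhds 0. Re (f z) > 0"
      using f(2) by (rule order_tendstoD)
    then show ?thesis
      unfolding eventually_nhds_metric by (auto simp: dist_commute)
  qed
  have "isCont csinc 0"
    using holomorphic_on_imp_continuous_on[OF holomorphic_csinc[of UNIV]]
    by (simp add: continuous_on_eq_continuous_at)
  with open_pos[of csinc] obtain r0 where r0: "r0 > 0" and
    pos: "\<And>z. z \<in> ball 0 r0 \<Longrightarrow> Re (csinc z) > 0"
    by (auto simp: csinc_def[of 0])
  let ?B = "ball (0::complex) r0"
  have nonpos: "csinc z \<notin> \<real>\<^sub>\<le>\<^sub>0" if "z \<in> ?B" for z
    using pos[OF that] by (auto simp: complex_nonpos_Reals_iff)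
  define H where "H z = - Ln (csinc z)" for z
  define H1 where "H1 z = (if z = 0 then deriv H 0 else H z / z)" for z
  define p where "p z = (if z = 0 then deriv H1 0 else H1 z / z)" for z
  have H0: "H 0 = 0" by (simp add: H_def csinc_def)
  have holH: "H holomorphic_on ?B"
    unfolding H_def[abs_def] by (intro holomorphic_intros holomorphic_csinc nonpos)
  have holH1: "H1 holomorphic_on ?B"
    unfolding H1_def[abs_def] by (rule holomorphic_div_zero[OF holH]) (auto simp: H0)
  have cont: "isCont f 0" if "f holomorphic_on ?B" for f
    using holomorphic_on_imp_continuous_on[OF that] r0
    by (simp add: continuous_on_eq_continuous_at)
  have small: "\<forall>\<^sub>F x in at_right (0::real). 0 < x \<and> x < r0 \<and> sin x / x > 0"
  proof -
    have "\<forall>\<^sub>F x in at_right (0::real). 0 < x \<and> x < r0"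
      using eventually_at_right_real[OF r0] by eventually_elim auto
    then show ?thesis
    proof eventually_elim
      case (elim x)
      then have "Re (csinc (of_real x)) > 0" by (intro pos) auto
      with elim show ?case unfolding csinc_of_real by simp
    qed
  qed
  have Hx: "H (of_real x) = of_real (- ln (sin x / x))" if "0 < x" "sin x / x > 0" for x
  proof -
    have "csinc (of_real x) = of_real (sin x / x)" using that(1) csinc_of_real[of x] by simp
    then show ?thesis using that(2) by (simp add: H_def Ln_of_real del: of_real_divide)
  qed
  have H10: "H1 0 = 0"
  proof (rule isCont_eq_real_limit[OF cont[OF holH1]])
    have "((\<lambda>x. - ln (sin x / x) / x) \<longlongrightarrow> 0) (at_right (0::real))" by real_asymp
    then have lim: "((\<lambda>x. complex_of_real (- ln (sin x / x) / x)) \<longlongrightarrow> of_real 0) (at_right (0::real))"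
      by (rule tendsto_of_real)
    have "\<forall>\<^sub>F x in at_right 0. complex_of_real (- ln (sin x / x) / x) = H1 (of_real x)"
      using small by eventually_elim (simp add: H1_def Hx)
    from Lim_transform_eventually[OF lim this]
    show "((\<lambda>x. H1 (of_real x)) \<longlongrightarrow> 0) (at_right 0)" by simp
  qed
  have holp: "p holomorphic_on ?B"
    unfolding p_def[abs_def] by (rule holomorphic_div_zero[OF holH1]) (auto simp: H10)
  have p0: "p 0 = 1 / 6"
  proof (rule isCont_eq_real_limit[OF cont[OF holp]])
    have "((\<lambda>x. - ln (sin x / x) / x / x) \<longlongrightarrow> 1 / 6) (at_right (0::real))" by real_asymp
    then have lim: "((\<lambda>x. complex_of_real (- ln (sin x / x) / x / x)) \<longlongrightarrow> of_real (1 / 6))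
        (at_right (0::real))"
      by (rule tendsto_of_real)
    have "\<forall>\<^sub>F x in at_right 0. complex_of_real (- ln (sin x / x) / x / x) = p (of_real x)"
      using small by eventually_elim (simp add: H1_def p_def Hx)
    from Lim_transform_eventually[OF lim this]
    show "((\<lambda>x. p (of_real x)) \<longlongrightarrow> 1 / 6) (at_right 0)" by simp
  qed
  obtain r1 where r1: "r1 > 0" "\<And>z. z \<in> ball 0 r1 \<Longrightarrow> Re (p z) > 0"
    using open_pos[OF cont[OF holp]] p0 by auto
  show ?thesis
  proof (rule that[of "min r0 r1" p])
    show "p holomorphic_on ball 0 (min r0 r1)"
      by (rule holomorphic_on_subset[OF holp]) auto
    show "exp (- (z\<^sup>2 * p z)) = csinc z" if "z \<in> ball 0 (min r0 r1)" for z
    proof -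
      have "z\<^sup>2 * p z = H z"
        by (simp add: p_def H1_def H0 power2_eq_square)
      moreover have "csinc z \<noteq> 0" using nonpos[of z] that by auto
      ultimately show ?thesis by (simp add: H_def)
    qed
    show "p (of_real x) \<in> \<real>" if "\<bar>x\<bar> < min r0 r1" for x
    proof (cases "x = 0")
      case False
      have "Re (csinc (of_real x)) > 0" using that by (intro pos) auto
      then have "sinc x > 0" unfolding csinc_of_real by simp
      then have "H (of_real x) \<in> \<real>" unfolding H_def csinc_of_real by (simp add: Ln_of_real del: of_real_divide)
      with False show ?thesis by (simp add: p_def H1_def)
    qed (simp add: p0)
  qed (use r0 r1 p0 in auto)
qed

text \<open>
  The phase is \<open>s(z) = z sqrt (p(z))\<close> with \<open>p\<close> as above: the principal square root is holomorphic and
  nonzero because \<open>Re p > 0\<close>, and \<open>s'(0) = sqrt (p(0)) = 1 / sqrt 6\<close>. The radius is then shrunk until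
  \<open>Re s'\<close> exceeds half of this value.
\<close>

lemma sinc_gaussian_phase:
  obtains s r \<delta> m where "gaussian_phase s r \<delta> m" "deriv s 0 = 1 / of_real (sqrt 6)"
    "\<And>x. x \<in> {-\<delta>..\<delta>} \<Longrightarrow> exp (- (Re (s (of_real x)))\<^sup>2) = sinc x"
proof -
  obtain r p where r: "r > 0" and p: "p holomorphic_on ball 0 r" "p 0 = 1 / 6"
    "\<And>z. z \<in> ball 0 r \<Longrightarrow> Re (p z) > 0"
    "\<And>z. z \<in> ball 0 r \<Longrightarrow> exp (- (z\<^sup>2 * p z)) = csinc z"
    "\<And>x. \<bar>x\<bar> < r \<Longrightarrow> p (of_real x) \<in> \<real>"
    using log_csinc_eq_square_mult by metis
  define s where "s z = z * csqrt (p z)" for z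
  have nonpos: "p z \<notin> \<real>\<^sub>\<le>\<^sub>0" if "z \<in> ball 0 r" for z
    using p(3)[OF that] by (auto simp: complex_nonpos_Reals_iff)
  have hcs: "(\<lambda>z. csqrt (p z)) holomorphic_on ball 0 r"
    by (intro holomorphic_intros p nonpos)
  then have hols: "s holomorphic_on ball 0 r"
    unfolding s_def[abs_def] by (intro holomorphic_on_mult holomorphic_on_ident)
  have s_sq: "exp (- (s z)\<^sup>2) = csinc z" if "z \<in> ball 0 r" for z
    using p(4)[OF that] by (simp add: s_def power_mult_distrib)
  have real: "s (of_real x) \<in> \<real>" if x: "\<bar>x\<bar> < r" for x
  proof -
    obtain y where y: "p (of_real x) = of_real y" using p(5)[OF x] by (rule Reals_cases)
    moreover have "y > 0" using p(3)[of "of_real x"] x y by simp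
    ultimately show ?thesis by (simp add: s_def csqrt_of_real)
  qed
  have s'0: "deriv s 0 = 1 / of_real (sqrt 6)"
  proof -
    have "((\<lambda>z. csqrt (p z)) has_field_derivative deriv (\<lambda>z. csqrt (p z)) 0) (at 0)"
      using holomorphic_derivI[OF hcs, of 0] r by simp
    then have "(s has_field_derivative csqrt (p 0)) (at 0)"
      unfolding s_def[abs_def] using DERIV_mult[OF DERIV_ident] by fastforce
    then have "deriv s 0 = csqrt (of_real (1 / 6))" by (simp add: p(2) DERIV_imp_deriv)
    also have "\<dots> = 1 / of_real (sqrt 6)"
      by (subst csqrt_of_real) (simp_all add: real_sqrt_divide)
    finally show ?thesis .
  qed
  have "isCont (deriv s) 0"
    using holomorphic_on_imp_continuous_on[OF holomorphic_deriv[OF hols]] r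
    by (simp add: continuous_on_eq_continuous_at)
  then have "((\<lambda>z. Re (deriv s z)) \<longlongrightarrow> Re (deriv s 0)) (nhds 0)"
    unfolding isCont_def tendsto_at_iff_tendsto_nhds by (intro tendsto_intros)
  moreover have "Re (deriv s 0) > 1 / (2 * sqrt 6)"
    unfolding s'0 by (simp add: Re_divide_of_real field_simps)
  ultimately have "\<forall>\<^sub>F z in nhds 0. Re (deriv s z) > 1 / (2 * sqrt 6)"
    by (rule order_tendstoD)
  then obtain r' where r': "r' > 0" "\<And>z. z \<in> ball 0 r' \<Longrightarrow> Re (deriv s z) > 1 / (2 * sqrt 6)"
    unfolding eventually_nhds_metric by (auto simp: dist_commute)
  define R where "R = min r r'"
  have R: "R > 0" "ball 0 R \<subseteq> ball (0::complex) r" "\<And>z. z \<in> ball 0 R \<Longrightarrow> Re (deriv s z) > 1 / (2 * sqrt 6)"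
    using r r' by (auto simp: R_def)
  show ?thesis
  proof (rule that[of s R "R / 2" "1 / (2 * sqrt 6)"])
    show "gaussian_phase s R (R / 2) (1 / (2 * sqrt 6))"
    proof
      show "s holomorphic_on ball 0 R" by (rule holomorphic_on_subset[OF hols R(2)])
      show "s (of_real x) \<in> \<real>" if "\<bar>x\<bar> < R" for x using real that by (simp add: R_def)
      show "s 0 = 0" by (simp add: s_def)
      show "s z \<noteq> 0" if "z \<in> ball 0 R" "z \<noteq> 0" for z
        using p(3)[of z] that R(2) by (auto simp: s_def subset_iff)
    qed (use R in \<open>auto intro: less_imp_le\<close>)
    show "deriv s 0 = 1 / of_real (sqrt 6)" by (rule s'0)
    fix x assume x: "x \<in> {- (R / 2)..R / 2}"
    then have x: "\<bar>x\<bar> < r" using R(1) by (auto simp: R_def)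
    define y where "y = Re (s (of_real x))"
    have "s (of_real x) = of_real y" using real[OF x] by (simp add: y_def complex_is_Real_iff complex_eq_iff)
    then have "complex_of_real (exp (- y\<^sup>2)) = of_real (sinc x)"
      using s_sq[of "of_real x"] x by (simp add: csinc_of_real exp_of_real[symmetric])
    then show "exp (- (Re (s (of_real x)))\<^sup>2) = sinc x"
      unfolding of_real_eq_iff y_def .
  qed
qed

section \<open>The sinc integral away from the origin\<close>

text \<open>
  For \<open>x \<ge> 2\<close> the bound \<open>1 / 2\<close> is immediate. For \<open>\<delta> \<le> x \<le> 2\<close>, the duplication formula
  \<open>sin x = 2 sin (x/2) cos (x/2)\<close> gives \<open>\<bar>sin x / x\<bar> \<le> cos (x/2) \<le> cos (\<delta>/2) < 1\<close>.
\<close>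

lemma abs_sinc_le_away_from_zero:
  fixes \<delta> :: real
  assumes "\<delta> > 0"
  obtains c where "0 < c" "c < 1" "\<And>x. x \<ge> \<delta> \<Longrightarrow> \<bar>sin x / x\<bar> \<le> c"
proof
  define d where "d = min \<delta> 2 / 2"
  have d: "0 < d" "d \<le> 1" using assms by (auto simp: d_def)
  let ?c = "max (1 / 2) (cos d)"
  show "0 < ?c" by simp
  have "cos d < cos 0"
    by (rule cos_monotone_0_pi) (use d pi_gt3 in auto)
  then show "?c < 1" by simp
  fix x assume x: "x \<ge> \<delta>"
  show "\<bar>sin x / x\<bar> \<le> ?c"
  proof (cases "x \<le> 2")
    case True
    have "\<bar>sin x\<bar> = 2 * \<bar>sin (x / 2)\<bar> * cos (x / 2)"
      using sin_double[of "x / 2"] cos_ge_zero[of "x / 2"] True x assms pi_gt3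
      by (simp add: abs_mult)
    also have "\<dots> \<le> 2 * (x / 2) * cos d"
    proof (rule mult_mono)
      show "2 * \<bar>sin (x / 2)\<bar> \<le> 2 * (x / 2)"
        using abs_sin_x_le_abs_x[of "x / 2"] x assms by simp
      show "cos (x / 2) \<le> cos d"
        by (rule cos_monotone_0_pi_le) (use True x d pi_gt3 in \<open>auto simp: d_def\<close>)
      show "0 \<le> cos (x / 2)"
        by (rule cos_ge_zero) (use True x assms pi_gt3 in auto)
    qed (use x assms in auto)
    finally show ?thesis using x assms by (simp add: divide_le_eq le_max_iff_disj mult.commute)
  next
    case False
    then have "2 * \<bar>sin x\<bar> \<le> x" using abs_sin_le_one[of x] by linarith
    then have "\<bar>sin x\<bar> / x \<le> 1 / 2" using False by (simp add: divide_le_eq)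
    then show ?thesis using False by (simp add: le_max_iff_disj)
  qed
qed

text \<open>
  Two of the \<open>n\<close> factors are bounded by \<open>1 / x\<close> to keep the tail integrable, the others by \<open>c\<close>; then
  the bound \<open>c^(n-2) / \<delta>\<close> holds for all upper limits \<open>T\<close> and hence in the limit.
\<close>

lemma sinc_power_integral_tail_le:
  assumes "\<delta> > 0" "c > 0" and c: "\<And>x. x \<ge> \<delta> \<Longrightarrow> \<bar>sin x / x\<bar> \<le> c" and n: "n \<ge> 2"
  shows "\<bar>sinc_power_integral n - integral {0..\<delta>} (\<lambda>x. (sin x / x) ^ n)\<bar> \<le> c ^ (n - 2) / \<delta>"
proof -
  let ?f = "\<lambda>x::real. (sin x / x) ^ n"
  have le: "\<bar>integral {0..T} ?f - integral {0..\<delta>} ?f\<bar> \<le> c ^ (n - 2) / \<delta>" if T: "T \<ge> \<delta>" for T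
  proof -
    have "integral {0..\<delta>} ?f + integral {\<delta>..T} ?f = integral {0..T} ?f"
      by (rule Henstock_Kurzweil_Integration.integral_combine) (use assms T integrable_on_sinc_power in auto)
    then have "\<bar>integral {0..T} ?f - integral {0..\<delta>} ?f\<bar> = norm (integral {\<delta>..T} ?f)"
      by simp
    also have "\<dots> \<le> integral {\<delta>..T} (\<lambda>x. c ^ (n - 2) * (1 / x\<^sup>2))"
    proof (rule integral_norm_bound_integral)
      show "?f integrable_on {\<delta>..T}"
        by (rule integrable_on_subinterval[OF integrable_on_sinc_power[of n T]]) (use assms in auto)
      show "(\<lambda>x. c ^ (n - 2) * (1 / x\<^sup>2)) integrable_on {\<delta>..T}"
        by (intro integrable_continuous_interval continuous_intros) (use assms in auto)
      fix x assume x: "x \<in> {\<delta>..T}"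
      have "norm (?f x) = \<bar>sin x / x\<bar> ^ (n - 2) * \<bar>sin x / x\<bar> ^ 2"
        using n by (simp only: real_norm_def power_abs power_add[symmetric] le_add_diff_inverse2)
      also have "\<dots> \<le> c ^ (n - 2) * (1 / x\<^sup>2)"
      proof (rule mult_mono[OF power_mono])
        have "\<bar>sin x\<bar> ^ 2 \<le> 1" by (simp add: abs_square_le_1)
        then show "\<bar>sin x / x\<bar> ^ 2 \<le> 1 / x\<^sup>2"
          by (simp add: power_divide divide_right_mono)
      qed (use assms x in auto)
      finally show "norm (?f x) \<le> c ^ (n - 2) * (1 / x\<^sup>2)" .
    qed
    also have "\<dots> = - (c ^ (n - 2)) / T - (- (c ^ (n - 2)) / \<delta>)"
    proof (rule integral_unique, rule fundamental_theorem_of_calculus[OF T])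
      fix x assume "x \<in> {\<delta>..T}"
      then have "x \<noteq> 0" using assms by auto
      then have "((\<lambda>x. - (c ^ (n - 2)) / x) has_real_derivative c ^ (n - 2) * (1 / x\<^sup>2)) (at x within {\<delta>..T})"
        by (auto intro!: derivative_eq_intros simp: power2_eq_square)
      then show "((\<lambda>x. - (c ^ (n - 2)) / x) has_vector_derivative c ^ (n - 2) * (1 / x\<^sup>2)) (at x within {\<delta>..T})"
        by (simp add: has_real_derivative_iff_has_vector_derivative)
    qed
    also have "\<dots> \<le> c ^ (n - 2) / \<delta>" using assms T by simp
    finally show ?thesis .
  qed
  have "((\<lambda>T. \<bar>integral {0..T} ?f - integral {0..\<delta>} ?f\<bar>)
      \<longlongrightarrow> \<bar>sinc_power_integral n - integral {0..\<delta>} ?f\<bar>) at_top"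
    using n by (intro tendsto_intros sinc_power_integral_converges) simp
  then show ?thesis
    by (rule tendsto_upperbound) (use eventually_mono[OF eventually_ge_at_top le] in auto)
qed

lemma integral_sinc_power_symmetric:
  assumes "\<delta> \<ge> 0"
  shows "integral {-\<delta>..\<delta>} (\<lambda>x. sinc x ^ n) = 2 * integral {0..\<delta>} (\<lambda>x. (sin x / x) ^ n)"
proof -
  let ?f = "\<lambda>x::real. sinc x ^ n"
  have "integral {-\<delta>..0} ?f = integral {-\<delta>..-0} (\<lambda>x. ?f (- x))"
    unfolding minus_zero by (rule integral_cong) simp
  also have "\<dots> = integral {0..\<delta>} ?f" by (rule Henstock_Kurzweil_Integration.integral_reflect_real[of \<delta> 0 ?f])
  moreover have "integral {-\<delta>..0} ?f + integral {0..\<delta>} ?f = integral {-\<delta>..\<delta>} ?f"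
    by (rule Henstock_Kurzweil_Integration.integral_combine)
       (use assms in \<open>auto intro!: integrable_continuous_interval continuous_intros\<close>)
  moreover have "integral {0..\<delta>} ?f = integral {0..\<delta>} (\<lambda>x. (sin x / x) ^ n)"
    by (rule integral_spike[of "{0}"]) auto
  ultimately show ?thesis by simp
qed

section \<open>The asymptotic expansion of the sinc integral\<close>

theorem theorem1p1:
  shows "\<exists>a :: nat \<Rightarrow> real. \<forall>k :: nat.
    (\<lambda>n :: nat. sqrt (2 * real n / (3 * pi)) * sinc_power_integral n
        - (1 + (\<Sum>\<nu>=1..k. a \<nu> / real n ^ \<nu>)))
      \<in> O(\<lambda>n. 1 / real n ^ (k + 1))"
proof -
  obtain s r \<delta> m where phase: "gaussian_phase s r \<delta> m" and s'0: "deriv s 0 = 1 / of_real (sqrt 6)"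
    and exp_s: "\<And>x. x \<in> {-\<delta>..\<delta>} \<Longrightarrow> exp (- (Re (s (of_real x)))\<^sup>2) = sinc x"
    using sinc_gaussian_phase by blast
  interpret gaussian_phase s r \<delta> m by (rule phase)
  obtain b where b0: "b 0 = sqrt pi * Re (1 / deriv s 0)" and
    b: "\<And>k. (\<lambda>n. sqrt (real n) * Re (J (\<lambda>_. 1) n) - (\<Sum>\<nu><k. b \<nu> / real n ^ \<nu>)) \<in> O(\<lambda>n. 1 / real n ^ k)"
    using asymptotic_expansion[of "\<lambda>_. 1"] by (auto intro: holomorphic_on_const)
  have J_eq: "Re (J (\<lambda>_. 1) n) = 2 * integral {0..\<delta>} (\<lambda>x. (sin x / x) ^ n)" for n
  proof -
    have "((\<lambda>x. sinc x ^ n) has_integral integral {-\<delta>..\<delta>} (\<lambda>x. sinc x ^ n)) {-\<delta>..\<delta>}"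
      by (intro integrable_integral integrable_continuous_interval continuous_intros)
    then have "((\<lambda>x. complex_of_real (sinc x ^ n)) has_integral
        of_real (integral {-\<delta>..\<delta>} (\<lambda>x. sinc x ^ n))) {-\<delta>..\<delta>}"
      using has_integral_linear[OF _ bounded_linear_of_real] unfolding o_def by blast
    then have "((\<lambda>x. 1 * complex_of_real (weight n x)) has_integral
        of_real (integral {-\<delta>..\<delta>} (\<lambda>x. sinc x ^ n))) {-\<delta>..\<delta>}"
    proof (rule has_integral_eq[rotated])
      fix x assume "x \<in> {-\<delta>..\<delta>}"
      moreover have "weight n x = exp (- (Re (s (of_real x)))\<^sup>2) ^ n"
        by (simp add: weight_def \<sigma>_def exp_of_nat_mult[symmetric])
      ultimately have "weight n x = sinc x ^ n" using exp_s by simp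
      then show "complex_of_real (sinc x ^ n) = 1 * complex_of_real (weight n x)" by simp
    qed
    then have "J (\<lambda>_. 1) n = of_real (integral {-\<delta>..\<delta>} (\<lambda>x. sinc x ^ n))"
      unfolding J_def by (rule integral_unique)
    then show ?thesis using integral_sinc_power_symmetric[of \<delta> n] \<delta>_pos by simp
  qed
  define C where "C = sqrt (2 / (3 * pi)) / 2"
  have C: "C \<noteq> 0" by (simp add: C_def)
  define a where "a \<nu> = C * b \<nu>" for \<nu>
  have a0: "a 0 = 1"
  proof -
    \<comment> \<open>\<open>\<integral> exp (- n x\<^sup>2 / 6) dx = sqrt (6 \<pi> / n)\<close> over the whole line is twice the leading term \<open>sqrt (3 \<pi> / (2 n))\<close>.\<close>
    have "a 0 = sqrt (2 / (3 * pi)) * sqrt pi * sqrt 6 / 2"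
      by (simp add: a_def C_def b0 s'0)
    also have "\<dots> = sqrt (2 / (3 * pi) * pi * 6) / 2"
      by (simp only: real_sqrt_mult)
    also have "2 / (3 * pi) * pi * 6 = 2\<^sup>2" by simp
    finally show ?thesis by simp
  qed
  obtain c where c: "0 < c" "c < 1" "\<And>x. x \<ge> \<delta> \<Longrightarrow> \<bar>sin x / x\<bar> \<le> c"
    using abs_sinc_le_away_from_zero[OF \<delta>_pos] by blast
  \<comment> \<open>The contribution of \<open>x \<ge> \<delta>\<close>.\<close>
  define e where "e n = sqrt (2 * real n / (3 * pi))
    * (sinc_power_integral n - integral {0..\<delta>} (\<lambda>x. (sin x / x) ^ n))" for n
  have e: "e \<in> O(\<lambda>n. 1 / real n ^ k)" for k
  proof (rule geometric_bigo_inverse_power[OF c(1,2)])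
    show "\<forall>\<^sub>F n in sequentially. \<bar>e n\<bar> \<le> sqrt (2 / (3 * pi)) / (\<delta> * c\<^sup>2) * sqrt (real n) * c ^ n"
      using eventually_ge_at_top[of 2]
    proof eventually_elim
      case (elim n)
      have "\<bar>e n\<bar> \<le> sqrt (2 * real n / (3 * pi)) * (c ^ (n - 2) / \<delta>)"
        unfolding e_def abs_mult using sinc_power_integral_tail_le[OF \<delta>_pos c(1,3) elim]
        by (intro mult_mono) auto
      also have "sqrt (2 * real n / (3 * pi)) = sqrt (2 / (3 * pi)) * sqrt (real n)"
        by (simp add: real_sqrt_mult real_sqrt_divide)
      also have "c ^ (n - 2) = c ^ n / c\<^sup>2"
        using c(1) elim by (simp add: power_diff)
      finally show ?case by (simp add: mult_ac)
    qed
  qed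
  show ?thesis
  proof (intro exI[of _ a] allI)
    fix k
    have "sqrt (2 * real n / (3 * pi)) * sinc_power_integral n - (1 + (\<Sum>\<nu>=1..k. a \<nu> / real n ^ \<nu>))
        = C * (sqrt (real n) * Re (J (\<lambda>_. 1) n) - (\<Sum>\<nu><k + 1. b \<nu> / real n ^ \<nu>)) + e n" for n
    proof -
      have "C * (\<Sum>\<nu><k + 1. b \<nu> / real n ^ \<nu>) = (\<Sum>\<nu><Suc k. a \<nu> / real n ^ \<nu>)"
        by (simp add: sum_distrib_left a_def distrib_left)
      also have "\<dots> = 1 + (\<Sum>\<nu>=1..k. a \<nu> / real n ^ \<nu>)"
        unfolding sum.lessThan_Suc_shift by (simp add: a0 sum.atLeast1_atMost_eq)
      finally have "C * (\<Sum>\<nu><k + 1. b \<nu> / real n ^ \<nu>) = 1 + (\<Sum>\<nu>=1..k. a \<nu> / real n ^ \<nu>)" .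
      moreover have "sqrt (2 * real n / (3 * pi)) = 2 * C * sqrt (real n)"
        by (simp add: C_def real_sqrt_mult real_sqrt_divide)
      ultimately show ?thesis
        by (simp add: e_def J_eq right_diff_distrib mult_ac)
    qed
    moreover have "(\<lambda>n. C * (sqrt (real n) * Re (J (\<lambda>_. 1) n) - (\<Sum>\<nu><k + 1. b \<nu> / real n ^ \<nu>)) + e n)
        \<in> O(\<lambda>n. 1 / real n ^ (k + 1))"
      using b[of "k + 1"] landau_o.big.cmult_in_iff[of C] C by (intro sum_in_bigo e) simp
    ultimately show "(\<lambda>n. sqrt (2 * real n / (3 * pi)) * sinc_power_integral n
        - (1 + (\<Sum>\<nu>=1..k. a \<nu> / real n ^ \<nu>))) \<in> O(\<lambda>n. 1 / real n ^ (k + 1))"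
      by (simp only:)
  qed
qed

end
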